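(* Let $p$ be a prime and let $F$ be a field of characteristic $0$ or greater than $p$. Let $\widetilde{F}=F(\alpha)$ be a field extension of $F$ of degree $p$ and let $\varphi=N_{\widetilde{F}/F}$ be its norm. Then Scharlau's norm principle holds for $\varphi$ for all finite Galois extensions $K/F$; that is, for every finite Galois extension $K/F$ and every $a\in K^\times$ with $a\varphi_K\cong\varphi_K$, one has $N_{K/F}(a)\varphi\cong\varphi$.
   Context: The norm $\varphi=N_{\widetilde F/F}$ is viewed as a form (homogeneous polynomial) of degree $p$ on the $F$-vector space $\widetilde F$, and $\varphi_K$ is its scalar extension to $\widetilde F\otimes_F K$ (the same homogeneous polynomial over $K$). Two forms $(V_1,\varphi_1)$, $(V_2,\varphi_2)$ are isomorphic, $\varphi_1\cong\varphi_2$, if there is a bijective linear map $f:V_1\to V_2$ with $\varphi_2(f(v))=\varphi_1(v)$ for all $v\in V_1$. *)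

theory Defs
  imports
    "HOL-Library.Poly_Mapping"
    "HOL-Computational_Algebra.Polynomial_Factorial"
    "Jordan_Normal_Form.Determinant"
begin

section \<open>Field extensions\<close>

text \<open>
  A field extension \<open>L/F\<close> is given by a field homomorphism \<open>\<iota> :: 'f \<Rightarrow> 'l\<close>
  (locale \<^locale>\<open>field_hom\<close>), \<open>F\<close> and \<open>L\<close> being the whole types.
\<close>

definition ext_scale :: "('f::field \<Rightarrow> 'l::field) \<Rightarrow> 'f \<Rightarrow> 'l \<Rightarrow> 'l" where
  "ext_scale \<iota> c x = \<iota> c * x"

text \<open>Because of the convention for \<^const>\<open>card\<close>, infinite extensions get degree 0.\<close>

definition ext_degree :: "('f::field \<Rightarrow> 'l::field) \<Rightarrow> nat" where
  "ext_degree \<iota> = vector_space.dim (ext_scale \<iota>) UNIV"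

definition finite_extension :: "('f::field \<Rightarrow> 'l::field) \<Rightarrow> bool" where
  "finite_extension \<iota> \<longleftrightarrow> (\<exists>B. finite B \<and> module.span (ext_scale \<iota>) B = UNIV)"

definition is_subfield :: "'l::field set \<Rightarrow> bool" where
  "is_subfield S \<longleftrightarrow> 0 \<in> S \<and> 1 \<in> S \<and>
     (\<forall>x\<in>S. \<forall>y\<in>S. x - y \<in> S \<and> x * y \<in> S) \<and> (\<forall>x\<in>S. inverse x \<in> S)"

definition adjoin :: "('f::field \<Rightarrow> 'l::field) \<Rightarrow> 'l \<Rightarrow> 'l set" where
  "adjoin \<iota> \<alpha> = \<Inter>{S. is_subfield S \<and> range \<iota> \<subseteq> S \<and> \<alpha> \<in> S}"

definition splits :: "'l::field poly \<Rightarrow> bool" where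
  "splits f \<longleftrightarrow> (\<exists>c A. f = smult c (\<Prod>x\<in>#A. [:- x, 1:]))"

definition normal_extension :: "('f::field \<Rightarrow> 'l::field) \<Rightarrow> bool" where
  "normal_extension \<iota> \<longleftrightarrow>
     (\<forall>f. irreducible f \<and> (\<exists>x. poly (map_poly \<iota> f) x = 0) \<longrightarrow> splits (map_poly \<iota> f))"

definition separable_extension :: "('f::field \<Rightarrow> 'l::field) \<Rightarrow> bool" where
  "separable_extension \<iota> \<longleftrightarrow>
     (\<forall>f. irreducible f \<and> (\<exists>x. poly (map_poly \<iota> f) x = 0) \<longrightarrow> coprime f (pderiv f))"

text \<open>
  Finite extensions are algebraic, so quantifying over the irreducible polynomials that
  have a root in \<open>L\<close> is quantifying over the minimal polynomials of the elements of \<open>L\<close>.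
\<close>

definition finite_galois_extension :: "('f::field \<Rightarrow> 'l::field) \<Rightarrow> bool" where
  "finite_galois_extension \<iota> \<longleftrightarrow>
     finite_extension \<iota> \<and> normal_extension \<iota> \<and> separable_extension \<iota>"


section \<open>The norm of a finite extension\<close>

definition is_ext_basis :: "('f::field \<Rightarrow> 'l::field) \<Rightarrow> 'l list \<Rightarrow> bool" where
  "is_ext_basis \<iota> bs \<longleftrightarrow> distinct bs \<and> \<not> module.dependent (ext_scale \<iota>) (set bs) \<and>
     module.span (ext_scale \<iota>) (set bs) = UNIV"

text \<open>
  A fixed ordered basis of \<open>L\<close> over \<open>F\<close>; only meaningful for finite extensions.
\<close>

definition ext_basis :: "('f::field \<Rightarrow> 'l::field) \<Rightarrow> 'l list" where
  "ext_basis \<iota> = (SOME bs. is_ext_basis \<iota> bs)"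

definition ext_coord :: "('f::field \<Rightarrow> 'l::field) \<Rightarrow> 'l \<Rightarrow> nat \<Rightarrow> 'f" where
  "ext_coord \<iota> x i =
     module.representation (ext_scale \<iota>) (set (ext_basis \<iota>)) x (ext_basis \<iota> ! i)"

text \<open>The matrix of the \<open>F\<close>-linear map \<open>y \<mapsto> x * y\<close> on \<open>L\<close>.\<close>

definition mult_matrix :: "('f::field \<Rightarrow> 'l::field) \<Rightarrow> 'l \<Rightarrow> 'f mat" where
  "mult_matrix \<iota> x =
     mat (ext_degree \<iota>) (ext_degree \<iota>) (\<lambda>(i, j). ext_coord \<iota> (x * ext_basis \<iota> ! j) i)"

definition field_norm :: "('f::field \<Rightarrow> 'l::field) \<Rightarrow> 'l \<Rightarrow> 'f" where
  "field_norm \<iota> x = det (mult_matrix \<iota> x)"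


section \<open>Forms\<close>

text \<open>Polynomials over \<open>'a\<close> in the variables \<open>X 0, X 1, \<dots>\<close>.\<close>

type_synonym 'a mvpoly = "(nat \<Rightarrow>\<^sub>0 nat) \<Rightarrow>\<^sub>0 'a"

definition eval_monom :: "(nat \<Rightarrow> 'a::comm_ring_1) \<Rightarrow> (nat \<Rightarrow>\<^sub>0 nat) \<Rightarrow> 'a" where
  "eval_monom x m = (\<Prod>i\<in>Poly_Mapping.keys m. x i ^ Poly_Mapping.lookup m i)"

definition eval_mvpoly :: "(nat \<Rightarrow> 'a::comm_ring_1) \<Rightarrow> 'a mvpoly \<Rightarrow> 'a" where
  "eval_mvpoly x P = (\<Sum>m\<in>Poly_Mapping.keys P. Poly_Mapping.lookup P m * eval_monom x m)"

definition homogeneous :: "nat \<Rightarrow> 'a::zero mvpoly \<Rightarrow> bool" where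
  "homogeneous d P \<longleftrightarrow>
     (\<forall>m\<in>Poly_Mapping.keys P. (\<Sum>i\<in>Poly_Mapping.keys m. Poly_Mapping.lookup m i) = d)"

text \<open>
  Isomorphism of a form \<open>\<phi>1\<close> on \<open>V1\<close> with a form \<open>\<phi>2\<close> on \<open>V2\<close>; the spaces are given by
  their carriers and scalar multiplications.
\<close>

definition forms_isomorphic ::
  "('a \<Rightarrow> 'v \<Rightarrow> 'v) \<Rightarrow> 'v::plus set \<Rightarrow> ('v \<Rightarrow> 'a::field) \<Rightarrow>
   ('a \<Rightarrow> 'w \<Rightarrow> 'w) \<Rightarrow> 'w::plus set \<Rightarrow> ('w \<Rightarrow> 'a) \<Rightarrow> bool" where
  "forms_isomorphic s1 V1 \<phi>1 s2 V2 \<phi>2 \<longleftrightarrow>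
     (\<exists>f. bij_betw f V1 V2 \<and>
          (\<forall>v\<in>V1. \<forall>w\<in>V1. f (v + w) = f v + f w) \<and>
          (\<forall>c. \<forall>v\<in>V1. f (s1 c v) = s2 c (f v)) \<and>
          (\<forall>v\<in>V1. \<phi>2 (f v) = \<phi>1 v))"


section \<open>The norm as a form, and its scalar extension\<close>

text \<open>
  With \<open>b\<close> the chosen basis, the norm of \<open>\<Sum>i. x i \<cdot> b i\<close> is the determinant of
  \<open>\<Sum>i. x i \<cdot> M i\<close>, where \<open>M i\<close> is the matrix of multiplication by \<open>b i\<close>. Replacing the
  scalars \<open>x i\<close> by variables gives the norm polynomial.
\<close>

definition norm_poly :: "('f::field \<Rightarrow> 'l::field) \<Rightarrow> 'f mvpoly" where
  "norm_poly \<iota> =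
     det (mat (ext_degree \<iota>) (ext_degree \<iota>) (\<lambda>(i, j).
       \<Sum>k<ext_degree \<iota>. Poly_Mapping.single (Poly_Mapping.single k 1)
                          (mult_matrix \<iota> (ext_basis \<iota> ! k) $$ (i, j))))"

text \<open>
  The \<open>K\<close>-space \<open>L \<otimes>\<^sub>F K\<close> has the basis \<open>b i \<otimes> 1\<close>; in these coordinates it is
  the space of vectors over \<open>K\<close> of dimension \<open>[L:F]\<close>, and the scalar extension of the norm
  is the norm polynomial with its coefficients mapped to \<open>K\<close>.
\<close>

definition norm_space_ext :: "('f::field \<Rightarrow> 'l::field) \<Rightarrow> ('f \<Rightarrow> 'k::field) \<Rightarrow> 'k vec set" where
  "norm_space_ext \<iota> \<kappa> = carrier_vec (ext_degree \<iota>)"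

definition norm_form_ext :: "('f::field \<Rightarrow> 'l::field) \<Rightarrow> ('f \<Rightarrow> 'k::field) \<Rightarrow> 'k vec \<Rightarrow> 'k" where
  "norm_form_ext \<iota> \<kappa> w = eval_mvpoly (\<lambda>i. w $ i) (Poly_Mapping.map \<kappa> (norm_poly \<iota>))"


section \<open>Basic facts\<close>

lemma vector_space_ext_scale:
  assumes "field_hom \<iota>"
  shows "vector_space (ext_scale \<iota>)"
proof -
  interpret field_hom \<iota> by fact
  show ?thesis
    by unfold_locales (auto simp: ext_scale_def hom_add hom_mult algebra_simps)
qed

lemma ext_basis:
  assumes "field_hom \<iota>" and "finite_extension \<iota>"
  shows "is_ext_basis \<iota> (ext_basis \<iota>)" and "length (ext_basis \<iota>) = ext_degree \<iota>"
proof -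
  interpret vector_space "ext_scale \<iota>" by (rule vector_space_ext_scale) fact
  obtain S where S: "finite S" "span S = UNIV"
    using assms(2) unfolding finite_extension_def by blast
  obtain B where B: "B \<subseteq> S" "independent B" "S \<subseteq> span B"
    using maximal_independent_subset[of S] by metis
  have "span B = UNIV" using S(2) B(3) span_minimal[OF B(3) subspace_span] by auto
  moreover obtain bs where "set bs = B" "distinct bs"
    using finite_distinct_list finite_subset[OF B(1) S(1)] by metis
  ultimately have "is_ext_basis \<iota> bs" using B(2) by (simp add: is_ext_basis_def)
  then show *: "is_ext_basis \<iota> (ext_basis \<iota>)" unfolding ext_basis_def by (rule someI)
  then have "dim UNIV = card (set (ext_basis \<iota>))"
    by (intro dim_eq_card) (auto simp: is_ext_basis_def)
  then show "length (ext_basis \<iota>) = ext_degree \<iota>"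
    using * by (simp add: ext_degree_def is_ext_basis_def distinct_card)
qed

lemma finite_extensionI_degree:
  assumes "field_hom \<iota>" and "ext_degree \<iota> > 0"
  shows "finite_extension \<iota>"
proof -
  interpret vector_space "ext_scale \<iota>" by (rule vector_space_ext_scale) fact
  obtain B where "UNIV \<subseteq> span B" "card B = dim UNIV"
    using basis_exists[of UNIV] by metis
  with assms(2) show ?thesis unfolding finite_extension_def ext_degree_def
    by (metis card_gt_0_iff top.extremum_uniqueI)
qed

lemma ext_coord_add:
  assumes "field_hom \<iota>" and "finite_extension \<iota>"
  shows "ext_coord \<iota> (x + y) i = ext_coord \<iota> x i + ext_coord \<iota> y i"
proof -
  interpret vector_space "ext_scale \<iota>" by (rule vector_space_ext_scale) fact
  show ?thesis using ext_basis(1)[OF assms]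
    by (simp add: ext_coord_def is_ext_basis_def representation_add)
qed

lemma ext_coord_scale:
  assumes "field_hom \<iota>" and "finite_extension \<iota>"
  shows "ext_coord \<iota> (\<iota> c * x) i = c * ext_coord \<iota> x i"
proof -
  interpret vector_space "ext_scale \<iota>" by (rule vector_space_ext_scale) fact
  show ?thesis using ext_basis(1)[OF assms] representation_scale[of "set (ext_basis \<iota>)" x c]
    by (simp add: ext_coord_def is_ext_basis_def ext_scale_def)
qed

lemma ext_coord_sum:
  assumes "field_hom \<iota>" and "finite_extension \<iota>" and "finite A"
  shows "ext_coord \<iota> (sum f A) i = (\<Sum>a\<in>A. ext_coord \<iota> (f a) i)"
proof -
  have "ext_coord \<iota> 0 i = 0"
    using ext_coord_scale[OF assms(1,2), of 0 0 i] by simp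
  with assms(3) show ?thesis
    by (induction A rule: finite_induct) (simp_all add: ext_coord_add[OF assms(1,2)])
qed

lemma sum_ext_coord:
  assumes "field_hom \<iota>" and "finite_extension \<iota>"
  shows "(\<Sum>k<ext_degree \<iota>. \<iota> (ext_coord \<iota> x k) * ext_basis \<iota> ! k) = x"
proof -
  interpret vector_space "ext_scale \<iota>" by (rule vector_space_ext_scale) fact
  let ?bs = "ext_basis \<iota>"
  have b: "is_ext_basis \<iota> ?bs" using ext_basis(1)[OF assms] .
  have "x = (\<Sum>v\<in>set ?bs. ext_scale \<iota> (representation (set ?bs) x v) v)"
    using b by (intro sum_representation_eq[symmetric]) (auto simp: is_ext_basis_def)
  also have "\<dots> = (\<Sum>k<length ?bs. ext_scale \<iota> (representation (set ?bs) x (?bs ! k)) (?bs ! k))"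
    using b by (intro sum.reindex_bij_betw[symmetric] bij_betw_nth) (auto simp: is_ext_basis_def)
  finally show ?thesis
    by (simp add: ext_basis(2)[OF assms] ext_coord_def ext_scale_def)
qed

lemma eval_mvpoly_superset:
  assumes "finite S" and "Poly_Mapping.keys P \<subseteq> S"
  shows "eval_mvpoly x P = (\<Sum>m\<in>S. Poly_Mapping.lookup P m * eval_monom x m)"
  unfolding eval_mvpoly_def using assms
  by (intro sum.mono_neutral_left) (auto simp: in_keys_iff)

lemma eval_mvpoly_add: "eval_mvpoly x (P + Q) = eval_mvpoly x P + eval_mvpoly x Q"
proof -
  let ?S = "Poly_Mapping.keys P \<union> Poly_Mapping.keys Q"
  have "eval_mvpoly x (P + Q) = (\<Sum>m\<in>?S. Poly_Mapping.lookup (P + Q) m * eval_monom x m)"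
    by (intro eval_mvpoly_superset keys_add) auto
  also have "\<dots> = eval_mvpoly x P + eval_mvpoly x Q"
    by (subst (1 2) eval_mvpoly_superset[of ?S])
       (auto simp: lookup_add distrib_right sum.distrib)
  finally show ?thesis .
qed

lemma eval_mvpoly_single: "eval_mvpoly x (Poly_Mapping.single m c) = c * eval_monom x m"
  by (cases "c = 0") (simp_all add: eval_mvpoly_def)

lemma eval_monom_superset:
  assumes "finite S" and "Poly_Mapping.keys m \<subseteq> S"
  shows "eval_monom x m = (\<Prod>i\<in>S. x i ^ Poly_Mapping.lookup m i)"
  unfolding eval_monom_def using assms
  by (intro prod.mono_neutral_left) (auto simp: in_keys_iff)

lemma eval_monom_add: "eval_monom x (m + n) = eval_monom x m * eval_monom x n"
proof -
  let ?S = "Poly_Mapping.keys m \<union> Poly_Mapping.keys n"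
  have "eval_monom x (m + n) = (\<Prod>i\<in>?S. x i ^ Poly_Mapping.lookup (m + n) i)"
    by (intro eval_monom_superset keys_add) auto
  also have "\<dots> = eval_monom x m * eval_monom x n"
    by (subst (1 2) eval_monom_superset[of ?S])
       (auto simp: lookup_add power_add prod.distrib)
  finally show ?thesis .
qed

lemma mvpoly_induct [case_names zero add_single]:
  assumes "Q 0" and "\<And>P m c. Q P \<Longrightarrow> Q (P + Poly_Mapping.single m c)"
  shows "Q (P :: 'a::comm_ring_1 mvpoly)"
proof (induction P rule: update_induct)
  case const
  then show ?case using assms(1) by simp
next
  case (update f a b)
  have "Poly_Mapping.update a b f = f + Poly_Mapping.single a b"
    using update.hyps
    by (intro poly_mapping_eqI) (auto simp: lookup_update lookup_add lookup_single in_keys_iff when_def)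
  then show ?case using assms(2)[OF update.IH] by simp
qed

lemma eval_mvpoly_hom: "comm_ring_hom (eval_mvpoly x)"
proof
  show "eval_mvpoly x 0 = 0" by (simp add: eval_mvpoly_def)
  then have 0: "eval_mvpoly x 0 = 0" .
  show "eval_mvpoly x (P + Q) = eval_mvpoly x P + eval_mvpoly x Q" for P Q
    by (rule eval_mvpoly_add)
  show "eval_mvpoly x 1 = 1"
    using eval_mvpoly_single[of x 0 1] by (simp add: eval_monom_def)
  have *: "eval_mvpoly x (P * Poly_Mapping.single n d) =
      eval_mvpoly x P * eval_mvpoly x (Poly_Mapping.single n d)" for P n d
    by (induction P rule: mvpoly_induct)
       (simp_all add: 0 distrib_right eval_mvpoly_add mult_single eval_mvpoly_single eval_monom_add)
  show "eval_mvpoly x (P * Q) = eval_mvpoly x P * eval_mvpoly x Q" for P Q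
    by (induction Q rule: mvpoly_induct) (simp_all add: 0 distrib_left eval_mvpoly_add *)
qed

text \<open>The norm polynomial represents the norm in the chosen coordinates.\<close>

theorem eval_norm_poly:
  assumes "field_hom \<iota>" and "finite_extension \<iota>"
  shows "eval_mvpoly (ext_coord \<iota> x) (norm_poly \<iota>) = field_norm \<iota> x"
proof -
  let ?n = "ext_degree \<iota>" and ?b = "\<lambda>k. ext_basis \<iota> ! k"
  interpret e: comm_ring_hom "eval_mvpoly (ext_coord \<iota> x)" by (rule eval_mvpoly_hom)
  have [simp]: "eval_monom (ext_coord \<iota> x) (Poly_Mapping.single k 1) = ext_coord \<iota> x k" for k
    by (simp add: eval_monom_def)
  have *: "ext_coord \<iota> (x * ?b j) i = (\<Sum>k<?n. ext_coord \<iota> (?b k * ?b j) i * ext_coord \<iota> x k)" for i j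
  proof -
    have "x * ?b j = (\<Sum>k<?n. \<iota> (ext_coord \<iota> x k) * (?b k * ?b j))"
      by (subst (1) sum_ext_coord[OF assms, of x, symmetric]) (simp add: sum_distrib_right mult.assoc)
    then show ?thesis
      by (simp add: ext_coord_sum[OF assms] ext_coord_scale[OF assms] mult.commute)
  qed
  show ?thesis
    unfolding norm_poly_def field_norm_def e.hom_det[symmetric]
    by (intro arg_cong[where f = det] eq_matI)
       (auto simp: mult_matrix_def e.hom_sum eval_mvpoly_single * simp del: One_nat_def)
qed

lemma homogeneous_add: "homogeneous d P \<Longrightarrow> homogeneous d Q \<Longrightarrow> homogeneous d (P + Q)"
  unfolding homogeneous_def by (meson UnE keys_add subsetD)

lemma homogeneous_sum: "(\<And>a. a \<in> A \<Longrightarrow> homogeneous d (f a)) \<Longrightarrow> homogeneous d (sum f A)"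
proof (induction A rule: infinite_finite_induct)
  case (insert a A)
  then show ?case by (simp add: homogeneous_add)
qed (simp_all add: homogeneous_def)

lemma homogeneous_mult:
  fixes P Q :: "'a::comm_ring_1 mvpoly"
  assumes "homogeneous d P" and "homogeneous e Q"
  shows "homogeneous (d + e) (P * Q)"
  unfolding homogeneous_def
proof
  have deg: "(\<Sum>i\<in>Poly_Mapping.keys m. Poly_Mapping.lookup m i) =
      (\<Sum>i\<in>S. Poly_Mapping.lookup m i)" if "finite S" "Poly_Mapping.keys m \<subseteq> S"
    for S and m :: "nat \<Rightarrow>\<^sub>0 nat"
    using that by (intro sum.mono_neutral_left) (auto simp: in_keys_iff)
  fix m assume "m \<in> Poly_Mapping.keys (P * Q)"
  then obtain a b where ab: "a \<in> Poly_Mapping.keys P" "b \<in> Poly_Mapping.keys Q" "m = a + b"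
    using keys_mult[of P Q] by blast
  let ?S = "Poly_Mapping.keys a \<union> Poly_Mapping.keys b"
  have "(\<Sum>i\<in>Poly_Mapping.keys m. Poly_Mapping.lookup m i) = (\<Sum>i\<in>?S. Poly_Mapping.lookup m i)"
    unfolding ab(3) by (intro deg keys_add) auto
  also have "\<dots> = (\<Sum>i\<in>?S. Poly_Mapping.lookup a i) + (\<Sum>i\<in>?S. Poly_Mapping.lookup b i)"
    by (simp add: ab(3) lookup_add sum.distrib)
  also have "\<dots> = d + e"
  proof -
    have "(\<Sum>i\<in>?S. Poly_Mapping.lookup a i) = d"
      using assms(1) ab(1) by (subst deg[symmetric]) (simp_all add: homogeneous_def)
    moreover have "(\<Sum>i\<in>?S. Poly_Mapping.lookup b i) = e"
      using assms(2) ab(2) by (subst deg[symmetric]) (simp_all add: homogeneous_def)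
    ultimately show ?thesis by simp
  qed
  finally show "(\<Sum>i\<in>Poly_Mapping.keys m. Poly_Mapping.lookup m i) = d + e" .
qed

theorem homogeneous_norm_poly: "homogeneous (ext_degree \<iota>) (norm_poly \<iota>)"
proof -
  let ?n = "ext_degree \<iota>"
  have prod: "homogeneous (card A) (\<Prod>a\<in>A. f a)"
    if "finite A" "\<And>a. a \<in> A \<Longrightarrow> homogeneous 1 (f a)" for A and f :: "nat \<Rightarrow> 'a mvpoly"
    using that
  proof (induction A rule: finite_induct)
    case empty
    then show ?case by (simp add: homogeneous_def)
  next
    case (insert a A)
    then show ?case using homogeneous_mult[of 1 "f a" "card A" "prod f A"] by simp
  qed
  have sign: "homogeneous d (signof p * P)" if "homogeneous d P"
    for p :: "nat \<Rightarrow> nat" and P :: "'a mvpoly" and d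
    using that by (auto simp: homogeneous_def sign_def)
  have "homogeneous 1 (\<Sum>k<?n. Poly_Mapping.single (Poly_Mapping.single k (1::nat)) (c k :: 'a))" for c
    by (intro homogeneous_sum) (auto simp: homogeneous_def)
  then have "homogeneous (card {0..<?n}) (\<Prod>i = 0..<?n. \<Sum>k<?n.
      Poly_Mapping.single (Poly_Mapping.single k (1::nat)) (c i k :: 'a))" for c
    by (intro prod) auto
  then have row: "homogeneous ?n (\<Prod>i = 0..<?n. \<Sum>k<?n.
      Poly_Mapping.single (Poly_Mapping.single k (1::nat)) (c i k :: 'a))" for c
    by simp
  let ?M = "mat ?n ?n (\<lambda>(i, j). \<Sum>k<?n. Poly_Mapping.single (Poly_Mapping.single k (1::nat))
              (mult_matrix \<iota> (ext_basis \<iota> ! k) $$ (i, j)))"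
  have "homogeneous ?n (\<Prod>i = 0..<?n. ?M $$ (i, q i))" if "q permutes {0..<?n}" for q
  proof -
    have "(\<Prod>i = 0..<?n. ?M $$ (i, q i)) =
        (\<Prod>i = 0..<?n. \<Sum>k<?n. Poly_Mapping.single (Poly_Mapping.single k (1::nat))
           (mult_matrix \<iota> (ext_basis \<iota> ! k) $$ (i, q i)))"
      using permutes_in_image[OF that] by (intro prod.cong) auto
    then show ?thesis using row by simp
  qed
  then have "homogeneous ?n (det ?M)"
    unfolding Determinant.det_def by (auto intro!: homogeneous_sum sign)
  then show ?thesis by (simp only: norm_poly_def)
qed

end

theory Submission
  imports Defs
begin

text \<open>
  Evaluating the isomorphism \<open>a \<phi>\<^sub>K \<cong> \<phi>\<^sub>K\<close> at \<open>1\<close> shows that \<open>a = \<phi>\<^sub>K(w)\<close> for some \<open>w\<close>, that is,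
  \<open>a\<close> is the determinant of multiplication by \<open>w\<close> on \<open>L \<otimes>\<^sub>F K\<close> over \<open>K\<close>. By transitivity of
  determinants, both \<open>N\<^bsub>K/F\<^esub>(a)\<close> and \<open>N\<^bsub>L/F\<^esub>(y)\<close>, where \<open>y\<close> is the determinant of the same
  map over \<open>L\<close>, equal its determinant over \<open>F\<close>. Hence multiplication by \<open>y\<close> is the required
  isomorphism.
\<close>

section \<open>Determinants of block matrices\<close>

text \<open>The range splits into \<open>n\<close> consecutive runs of length \<open>m\<close>. This
  is how an index of a block matrix is read as the pair of its block and its position inside the
  block.\<close>

lemma sum_div_mod:
  fixes f :: "nat \<Rightarrow> nat \<Rightarrow> 'a::comm_monoid_add"
  shows "(\<Sum>k = 0..<n * m. f (k div m) (k mod m)) = (\<Sum>a = 0..<n. \<Sum>b = 0..<m. f a b)"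
proof -
  have "(\<Sum>k = 0..<n * m. f (k div m) (k mod m)) =
      (\<Sum>a<n. \<Sum>k = a * m..<a * m + m. f (k div m) (k mod m))"
    by (simp add: sum.nat_group atLeast0LessThan)
  also have "\<dots> = (\<Sum>a<n. \<Sum>b = 0..<m. f a b)"
  proof (rule sum.cong[OF refl])
    fix a
    have "(\<Sum>k = a * m..<a * m + m. f (k div m) (k mod m)) =
        (\<Sum>b = 0..<m. f ((b + a * m) div m) ((b + a * m) mod m))"
      using sum.shift_bounds_nat_ivl[of "\<lambda>k. f (k div m) (k mod m)" 0 "a * m" m]
      by (simp add: add.commute)
    also have "\<dots> = (\<Sum>b = 0..<m. f a b)"
      by (rule sum.cong) auto
    finally show "(\<Sum>k = a * m..<a * m + m. f (k div m) (k mod m)) = (\<Sum>b = 0..<m. f a b)" .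
  qed
  finally show ?thesis by (simp add: atLeast0LessThan)
qed

text \<open>Permuting rows and columns alike is conjugation by a permutation matrix. Transposition
  reduces columns to rows, and the sign occurs twice, hence cancels.\<close>

lemma det_permute:
  fixes A :: "'a::comm_ring_1 mat"
  assumes A: "A \<in> carrier_mat n n" and q: "q permutes {0..<n}"
  shows "det (mat n n (\<lambda>(i, j). A $$ (q i, q j))) = det A"
proof -
  let ?B = "mat n n (\<lambda>(i, j). A $$ (q i, j))"
  let ?C = "transpose_mat ?B"
  have q': "q i < n" if "i < n" for i using permutes_in_image[OF q, of i] that by simp
  have "mat n n (\<lambda>(i, j). A $$ (q i, q j)) =
      transpose_mat (mat n n (\<lambda>(i, j). ?C $$ (q i, j)))"
    by (rule eq_matI) (auto simp: q')
  then have "det (mat n n (\<lambda>(i, j). A $$ (q i, q j))) =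
      det (mat n n (\<lambda>(i, j). ?C $$ (q i, j)))"
    by (simp add: det_transpose[of _ n])
  also have "\<dots> = signof q * det ?C"
    by (rule det_permute_rows[OF _ q]) simp
  also have "det ?C = signof q * det A"
    by (simp add: det_transpose[of _ n] det_permute_rows[OF A q])
  finally show ?thesis by (simp add: sign_def)
qed

text \<open>Both matrices describe one map on a tensor product, with the basis ordered by the first
  or by the second factor. They are therefore conjugate by a permutation of the index pairs.\<close>

lemma det_block_interchange:
  fixes g :: "nat \<Rightarrow> nat \<Rightarrow> nat \<Rightarrow> nat \<Rightarrow> 'a::comm_ring_1"
  shows "det (mat (n * m) (n * m) (\<lambda>(i, j). g (i div m) (j div m) (i mod m) (j mod m))) =
    det (mat (m * n) (m * n) (\<lambda>(i, j). g (i mod n) (j mod n) (i div n) (j div n)))"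
    (is "det ?A = det ?B")
proof -
  \<comment> \<open>\<open>q\<close> turns the index \<open>c * n + a\<close> of the pair
    \<open>(a, c)\<close> into its index \<open>a * m + c\<close>. Outside the range it is the
    identity, as \<open>permutes\<close> demands.\<close>
  define q where "q i = (if i < n * m then (i mod n) * m + i div n else i)" for i
  have lt: "q i < n * m \<and> q i div m = i mod n \<and> q i mod m = i div n" if "i < n * m" for i
  proof -
    have n: "n > 0" using that by (cases n) auto
    have 1: "i div n < m" using that less_mult_imp_div_less[of i m n] by (simp add: mult.commute)
    have "(i mod n) * m + i div n < (i mod n + 1) * m" using 1 by simp
    also have "\<dots> \<le> n * m" using n by (intro mult_right_mono) (simp_all add: Suc_leI)
    finally show ?thesis using that 1 by (simp add: q_def)
  qed
  have "inj_on q {0..<n * m}"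
  proof (rule inj_onI)
    fix i j assume "i \<in> {0..<n * m}" "j \<in> {0..<n * m}" "q i = q j"
    then have "i mod n = j mod n" "i div n = j div n" using lt[of i] lt[of j] by auto
    then show "i = j" by (metis div_mult_mod_eq)
  qed
  moreover have "q ` {0..<n * m} \<subseteq> {0..<n * m}" using lt by auto
  ultimately have "bij_betw q {0..<n * m} {0..<n * m}"
    by (simp add: bij_betw_def endo_inj_surj)
  then have "q permutes {0..<n * m}"
    by (rule bij_imp_permutes) (auto simp: q_def)
  then have "det ?A = det (mat (n * m) (n * m) (\<lambda>(i, j). ?A $$ (q i, q j)))"
    by (intro det_permute[symmetric]) auto
  also have "mat (n * m) (n * m) (\<lambda>(i, j). ?A $$ (q i, q j)) = ?B"
    by (rule eq_matI) (use lt in \<open>auto simp: mult.commute\<close>)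
  finally show ?thesis .
qed

section \<open>Matrix representations of a field and the block matrices they induce\<close>

locale matrix_representation =
  fixes m :: nat and \<rho> :: "'k::field \<Rightarrow> 'f::idom mat"
  assumes dim_pos: "m > 0"
    and carrier [simp]: "\<rho> x \<in> carrier_mat m m"
    and one: "\<rho> 1 = 1\<^sub>m m"
    and add: "\<rho> (x + y) = \<rho> x + \<rho> y"
    and mult: "\<rho> (x * y) = \<rho> x * \<rho> y"
begin

text \<open>Restriction of scalars: when \<open>\<rho>\<close> is a regular representation, this is
  the matrix over the smaller field of the map with matrix \<open>M\<close> over the larger
  one.\<close>

definition block :: "nat \<Rightarrow> 'k mat \<Rightarrow> 'f mat" where
  "block n M = mat (n * m) (n * m)
     (\<lambda>(i, j). \<rho> (M $$ (i div m, j div m)) $$ (i mod m, j mod m))"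

lemma dim [simp]: "dim_row (\<rho> x) = m" "dim_col (\<rho> x) = m"
  using carrier[of x] unfolding carrier_mat_def by auto

lemma block_carrier [simp]: "block n M \<in> carrier_mat (n * m) (n * m)"
  by (simp add: block_def)

lemma block_dim [simp]: "dim_row (block n M) = n * m" "dim_col (block n M) = n * m"
  by (simp_all add: block_def)

lemma div_less: "i < n * m \<Longrightarrow> i div m < n"
  by (simp add: less_mult_imp_div_less)

lemma mod_less: "i mod m < m"
  using dim_pos by simp

lemma zero_entry [simp]:
  assumes "i < m" and "j < m"
  shows "\<rho> 0 $$ (i, j) = 0"
proof -
  have "\<rho> (0 + 0) $$ (i, j) = \<rho> 0 $$ (i, j) + \<rho> 0 $$ (i, j)"
    using assms by (subst add) simp
  then show ?thesis by (metis add_0 add_cancel_right_left)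
qed

lemma zero: "\<rho> 0 = 0\<^sub>m m m"
  by (rule eq_matI) auto

lemma add_entry: "i < m \<Longrightarrow> j < m \<Longrightarrow> \<rho> (x + y) $$ (i, j) = \<rho> x $$ (i, j) + \<rho> y $$ (i, j)"
  by (simp add: add)

lemma sum_entry:
  "i < m \<Longrightarrow> j < m \<Longrightarrow> \<rho> (sum f A) $$ (i, j) = (\<Sum>a\<in>A. \<rho> (f a) $$ (i, j))"
  by (induction A rule: infinite_finite_induct) (simp_all add: add_entry)

lemma mult_entry:
  "i < m \<Longrightarrow> j < m \<Longrightarrow> \<rho> (x * y) $$ (i, j) = (\<Sum>k = 0..<m. \<rho> x $$ (i, k) * \<rho> y $$ (k, j))"
  by (simp add: mult scalar_prod_def)

text \<open>\<open>\<rho>\<close> respects sums and products, so the sum over blocks and the sums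
  inside their products merge into a single sum over \<open>n * m\<close> indices.\<close>

lemma block_mult:
  assumes "A \<in> carrier_mat n n" and "B \<in> carrier_mat n n"
  shows "block n (A * B) = block n A * block n B"
proof (rule eq_matI)
  fix i j assume "i < dim_row (block n A * block n B)" "j < dim_col (block n A * block n B)"
  then have ij: "i < n * m" "j < n * m" by (simp_all add: block_def)
  have "block n (A * B) $$ (i, j) =
      \<rho> (\<Sum>k = 0..<n. A $$ (i div m, k) * B $$ (k, j div m)) $$ (i mod m, j mod m)"
    using ij assms div_less by (simp add: block_def scalar_prod_def)
  also have "\<dots> = (\<Sum>k = 0..<n. \<Sum>l = 0..<m.
      \<rho> (A $$ (i div m, k)) $$ (i mod m, l) * \<rho> (B $$ (k, j div m)) $$ (l, j mod m))"
    by (simp add: sum_entry mult_entry mod_less)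
  also have "\<dots> = (block n A * block n B) $$ (i, j)"
    using ij by (simp add: block_def scalar_prod_def
      flip: sum_div_mod[of "\<lambda>k l. \<rho> (A $$ (i div m, k)) $$ (i mod m, l) *
        \<rho> (B $$ (k, j div m)) $$ (l, j mod m)"])
  finally show "block n (A * B) $$ (i, j) = (block n A * block n B) $$ (i, j)" .
qed (simp_all add: block_def)

lemma block_diag_eq_1:
  assumes "i < n * m" and "M $$ (i div m, i div m) = 1"
  shows "block n M $$ (i, i) = 1"
  using assms mod_less by (simp add: block_def one)

text \<open>Distinct indices either lie in different blocks, where \<open>\<rho> 0\<close> vanishes,
  or at different positions of the same diagonal block, which is \<open>\<rho> 1\<close>, the
  identity.\<close>

lemma block_off_diag_eq_0:
  assumes "i < n * m" and "j < n * m" and "i \<noteq> j"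
    and "i div m \<noteq> j div m \<Longrightarrow> M $$ (i div m, j div m) = 0"
    and "i div m = j div m \<Longrightarrow> M $$ (i div m, j div m) = 1"
  shows "block n M $$ (i, j) = 0"
proof (cases "i div m = j div m")
  case True
  then have "i mod m \<noteq> j mod m" using assms(3) by (metis div_mult_mod_eq)
  with True show ?thesis using assms mod_less by (simp add: block_def one)
next
  case False
  then show ?thesis using assms mod_less by (simp add: block_def)
qed

text \<open>The block expansion is again unitriangular: diagonal blocks are identities, zero blocks
  stay zero, and division by \<open>m\<close> is monotone.\<close>

lemma det_block_upper_unitriangular:
  assumes "\<And>i. i < n \<Longrightarrow> M $$ (i, i) = 1"
    and "\<And>i j. i < n \<Longrightarrow> j < i \<Longrightarrow> M $$ (i, j) = 0"
  shows "det (block n M) = 1"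
proof -
  have "block n M $$ (i, j) = 0" if "i < n * m" "j < i" for i j
  proof (rule block_off_diag_eq_0)
    show "M $$ (i div m, j div m) = 0" if "i div m \<noteq> j div m"
      using that \<open>j < i\<close> \<open>i < n * m\<close> div_le_mono[of j i m]
      by (intro assms(2)) (auto intro: div_less)
  qed (use that assms(1) div_less in auto)
  then have "det (block n M) = prod_list (diag_mat (block n M))"
    by (intro det_upper_triangular[of _ "n * m"]) (auto simp: block_def)
  also have "\<dots> = 1"
    unfolding prod_list_diag_prod
    by (rule prod.neutral) (auto intro!: block_diag_eq_1 assms(1) div_less)
  finally show ?thesis .
qed

lemma det_block_lower_unitriangular:
  assumes "\<And>i. i < n \<Longrightarrow> M $$ (i, i) = 1"
    and "\<And>i j. i < j \<Longrightarrow> j < n \<Longrightarrow> M $$ (i, j) = 0"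
  shows "det (block n M) = 1"
proof -
  have "block n M $$ (i, j) = 0" if "i < j" "j < n * m" for i j
  proof (rule block_off_diag_eq_0)
    show "M $$ (i div m, j div m) = 0" if "i div m \<noteq> j div m"
      using that \<open>i < j\<close> \<open>j < n * m\<close> div_le_mono[of i j m]
      by (intro assms(2)) (auto intro: div_less)
  qed (use that assms(1) div_less in auto)
  then have "det (block n M) = prod_list (diag_mat (block n M))"
    by (intro det_lower_triangular[of "n * m"]) auto
  also have "\<dots> = 1"
    unfolding prod_list_diag_prod
    by (rule prod.neutral) (auto intro!: block_diag_eq_1 assms(1) div_less)
  finally show ?thesis .
qed

text \<open>Lets the first row and column be split off: \<open>M\<close> and its block expansion are
  both block triangular, with the pivot or its image under \<open>\<rho>\<close> in the
  corner.\<close>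

lemma det_zero_below_pivot:
  assumes M: "M \<in> carrier_mat (Suc n) (Suc n)"
    and "\<And>i. 0 < i \<Longrightarrow> i < Suc n \<Longrightarrow> M $$ (i, 0) = 0"
  shows "det (block (Suc n) M) = det (\<rho> (M $$ (0, 0))) *
    det (block n (mat n n (\<lambda>(i, j). M $$ (Suc i, Suc j))))"
    and "det M = M $$ (0, 0) * det (mat n n (\<lambda>(i, j). M $$ (Suc i, Suc j)))"
proof -
  let ?B = "mat n n (\<lambda>(i, j). M $$ (Suc i, Suc j))"
  let ?R = "mat m (n * m) (\<lambda>(i, j). \<rho> (M $$ (0, Suc (j div m))) $$ (i, j mod m))"
  have "block (Suc n) M = four_block_mat (\<rho> (M $$ (0, 0))) ?R (0\<^sub>m (n * m) m) (block n ?B)"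
    (is "_ = ?F")
  proof (rule eq_matI)
    fix i j assume "i < dim_row ?F" "j < dim_col ?F"
    then have ij: "i < m + n * m" "j < m + n * m" by (simp_all add: block_def)
    \<comment> \<open>The first block row has height \<open>m\<close>, so past it the block numbers
      of the minor lag by one while the positions inside a block agree.\<close>
    have *: "k div m = Suc ((k - m) div m) \<and> k mod m = (k - m) mod m" if "\<not> k < m" for k
      using that dim_pos by (simp add: le_div_geq le_mod_geq)
    have lt: "(k - m) div m < n" if "k < m + n * m" "\<not> k < m" for k
      using that by (intro div_less) auto
    show "block (Suc n) M $$ (i, j) = ?F $$ (i, j)"
      using ij * lt assms(2) mod_less by (auto simp: block_def)
  qed (simp_all add: block_def)
  then show "det (block (Suc n) M) = det (\<rho> (M $$ (0, 0))) * det (block n ?B)"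
    by (simp add: det_four_block_mat_lower_left_zero[of _ m _ "n * m"])
  have "M = four_block_mat (mat 1 1 (\<lambda>_. M $$ (0, 0)))
      (mat 1 n (\<lambda>(i, j). M $$ (0, Suc j))) (0\<^sub>m n 1) ?B"
    using M assms(2) by (intro eq_matI) auto
  then have "det M = det (mat 1 1 (\<lambda>_. M $$ (0, 0))) * det ?B"
    by (metis det_four_block_mat_lower_left_zero mat_carrier)
  then show "det M = M $$ (0, 0) * det ?B"
    by (simp add: det_single)
qed

text \<open>
  Both sides are multiplicative in \<open>M\<close>, so \<open>M\<close> may be multiplied by unitriangular matrices
  until its first column vanishes below the diagonal.
\<close>

theorem det_block: "M \<in> carrier_mat n n \<Longrightarrow> det (block n M) = det (\<rho> (det M))"
proof (induction n arbitrary: M)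
  case 0
  then show ?case by (simp add: block_def one)
next
  case (Suc n)
  \<comment> \<open>With the first column cleared, the induction hypothesis handles the minor, and
    multiplicativity of \<open>\<rho>\<close> joins it to the pivot.\<close>
  have step: "det (block (Suc n) M) = det (\<rho> (det M))"
    if M: "M \<in> carrier_mat (Suc n) (Suc n)"
      and 0: "\<And>i. 0 < i \<Longrightarrow> i < Suc n \<Longrightarrow> M $$ (i, 0) = 0" for M
    using det_zero_below_pivot[OF that]
    by (simp add: Suc.IH mult det_mult[OF carrier carrier])
  \<comment> \<open>Left multiplication by \<open>T\<close> changes neither side of the claim when
    \<open>T\<close> and its block expansion both have determinant 1.\<close>
  have reduce: "det (block (Suc n) M) = det (\<rho> (det M))"
    if "det (block (Suc n) (T * M)) = det (\<rho> (det (T * M)))"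
      and "det (block (Suc n) T) = 1" and "det T = 1"
      and "T \<in> carrier_mat (Suc n) (Suc n)" and "M \<in> carrier_mat (Suc n) (Suc n)" for T M
    using that by (simp add: block_mult det_mult[of _ "Suc n"] det_mult[OF block_carrier block_carrier])
  have pivot: "det (block (Suc n) M) = det (\<rho> (det M))"
    if M: "M \<in> carrier_mat (Suc n) (Suc n)" and nz: "M $$ (0, 0) \<noteq> 0" for M
  \<comment> \<open>Gaussian elimination: each later row loses the multiple of row 0 that cancels
    its first entry.\<close>
  proof (rule reduce[of "mat (Suc n) (Suc n) (\<lambda>(i, j). if i = j then 1
      else if j = 0 then - M $$ (i, 0) / M $$ (0, 0) else 0)"])
    let ?T = "mat (Suc n) (Suc n) (\<lambda>(i, j). if i = j then 1
      else if j = 0 then - M $$ (i, 0) / M $$ (0, 0) else 0)"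
    have "(?T * M) $$ (i, 0) = 0" if i: "0 < i" "i < Suc n" for i
    proof -
      have "(?T * M) $$ (i, 0) = (\<Sum>k = 0..<Suc n. ?T $$ (i, k) * M $$ (k, 0))"
        using i M by (simp add: scalar_prod_def)
      also have "\<dots> = (\<Sum>k\<in>{0, i}. ?T $$ (i, k) * M $$ (k, 0))"
        using i by (intro sum.mono_neutral_right) auto
      also have "\<dots> = 0" using i nz by simp
      finally show ?thesis .
    qed
    then show "det (block (Suc n) (?T * M)) = det (\<rho> (det (?T * M)))"
      using M by (intro step) auto
    show "det (block (Suc n) ?T) = 1"
      by (rule det_block_lower_unitriangular) auto
    have "det ?T = prod_list (diag_mat ?T)"
      by (rule det_lower_triangular[of "Suc n"]) auto
    also have "\<dots> = 1" unfolding prod_list_diag_prod by (rule prod.neutral) auto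
    finally show "det ?T = 1" .
  qed (use M in auto)
  show ?case
  proof (cases "\<exists>r. 0 < r \<and> r < Suc n \<and> M $$ (r, 0) \<noteq> 0")
    case False
    then show ?thesis using step Suc.prems by blast
  next
    case True
    then obtain r where r: "0 < r" "r < Suc n" "M $$ (r, 0) \<noteq> 0" by blast
    show ?thesis
    proof (cases "M $$ (0, 0) = 0")
      case False
      then show ?thesis using pivot Suc.prems by blast
    next
      case zero: True
      \<comment> \<open>Adding row \<open>r\<close> to row 0, instead of swapping the two, creates a
        nonzero pivot with an upper unitriangular factor.\<close>
      let ?T = "mat (Suc n) (Suc n) (\<lambda>(i, j). if i = j \<or> i = 0 \<and> j = r then 1 else 0)"
      show ?thesis
      proof (rule reduce[of ?T])
        have "(?T * M) $$ (0, 0) = (\<Sum>k = 0..<Suc n. ?T $$ (0, k) * M $$ (k, 0))"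
          using Suc.prems by (simp add: scalar_prod_def)
        also have "\<dots> = (\<Sum>k\<in>{0, r}. ?T $$ (0, k) * M $$ (k, 0))"
          using r by (intro sum.mono_neutral_right) auto
        also have "\<dots> = M $$ (r, 0)" using r zero by simp
        finally show "det (block (Suc n) (?T * M)) = det (\<rho> (det (?T * M)))"
          using r Suc.prems by (intro pivot) auto
        show "det (block (Suc n) ?T) = 1"
          by (rule det_block_upper_unitriangular) (use r in auto)
        have "det ?T = prod_list (diag_mat ?T)"
          by (rule det_upper_triangular[of _ "Suc n"]) (use r in auto)
        also have "\<dots> = 1" unfolding prod_list_diag_prod by (rule prod.neutral) auto
        finally show "det ?T = 1" .
      qed (use Suc.prems in auto)
    qed
  qed
qed

end

section \<open>The regular representation\<close>

lemma ext_degree_pos: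
  assumes "field_hom \<iota>" and "finite_extension \<iota>"
  shows "ext_degree \<iota> > 0"
proof (rule ccontr)
  assume "\<not> ext_degree \<iota> > 0"
  \<comment> \<open>Degree 0 would make the basis expansion of 1 an empty sum.\<close>
  then have "(1 :: 'b) = 0" using sum_ext_coord[OF assms, of 1] by simp
  then show False by simp
qed

lemma ext_coord_basis:
  assumes "field_hom \<iota>" and "finite_extension \<iota>" and "i < ext_degree \<iota>" and "j < ext_degree \<iota>"
  shows "ext_coord \<iota> (ext_basis \<iota> ! j) i = (if i = j then 1 else 0)"
proof -
  interpret vector_space "ext_scale \<iota>" by (rule vector_space_ext_scale) fact
  have b: "is_ext_basis \<iota> (ext_basis \<iota>)" "length (ext_basis \<iota>) = ext_degree \<iota>"
    using ext_basis[OF assms(1,2)] .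
  then have "representation (set (ext_basis \<iota>)) (ext_basis \<iota> ! j) =
      (\<lambda>v. if v = ext_basis \<iota> ! j then 1 else 0)"
    using assms(4) by (intro representation_basis) (auto simp: is_ext_basis_def)
  then show ?thesis
    using b assms(3,4) by (simp add: ext_coord_def is_ext_basis_def nth_eq_iff_index_eq)
qed

lemma matrix_representation_mult_matrix:
  assumes "field_hom \<iota>" and "finite_extension \<iota>"
  shows "matrix_representation (ext_degree \<iota>) (mult_matrix \<iota>)"
proof
  let ?n = "ext_degree \<iota>" and ?b = "\<lambda>k. ext_basis \<iota> ! k"
  show "?n > 0" using ext_degree_pos[OF assms] .
  show "mult_matrix \<iota> x \<in> carrier_mat ?n ?n" for x by (simp add: mult_matrix_def)
  show "mult_matrix \<iota> 1 = 1\<^sub>m ?n"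
    by (rule eq_matI) (auto simp: mult_matrix_def ext_coord_basis[OF assms])
  show "mult_matrix \<iota> (x + y) = mult_matrix \<iota> x + mult_matrix \<iota> y" for x y
    by (rule eq_matI) (auto simp: mult_matrix_def distrib_right ext_coord_add[OF assms])
  show "mult_matrix \<iota> (x * y) = mult_matrix \<iota> x * mult_matrix \<iota> y" for x y
  proof (rule eq_matI)
    fix i j assume "i < dim_row (mult_matrix \<iota> x * mult_matrix \<iota> y)"
      "j < dim_col (mult_matrix \<iota> x * mult_matrix \<iota> y)"
    then have ij: "i < ?n" "j < ?n" by (simp_all add: mult_matrix_def)
    \<comment> \<open>The coefficients form column \<open>j\<close> of the matrix of
      \<open>y\<close>; taking coordinates of each \<open>x * ?b k\<close> then yields the matrix
      product.\<close>
    have "x * y * ?b j = (\<Sum>k<?n. \<iota> (ext_coord \<iota> (y * ?b j) k) * (x * ?b k))"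
      by (subst (1) mult.assoc, subst (1) sum_ext_coord[OF assms, of "y * ?b j", symmetric])
         (simp add: sum_distrib_left mult.left_commute)
    then show "mult_matrix \<iota> (x * y) $$ (i, j) = (mult_matrix \<iota> x * mult_matrix \<iota> y) $$ (i, j)"
      using ij by (simp add: mult_matrix_def scalar_prod_def ext_coord_sum[OF assms]
          ext_coord_scale[OF assms] mult.commute[of "ext_coord \<iota> (y * ?b j) _"] atLeast0LessThan)
  qed (simp_all add: mult_matrix_def)
qed

lemma mult_matrix_scale_entry:
  assumes "field_hom \<iota>" and "finite_extension \<iota>" and "i < ext_degree \<iota>" and "j < ext_degree \<iota>"
  shows "mult_matrix \<iota> (\<iota> c * x) $$ (i, j) = c * mult_matrix \<iota> x $$ (i, j)"
  using assms by (simp add: mult_matrix_def mult.assoc ext_coord_scale)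

section \<open>Multiplicativity and zeros of the norm\<close>

lemma field_norm_mult:
  assumes "field_hom \<iota>" and "finite_extension \<iota>"
  shows "field_norm \<iota> (x * y) = field_norm \<iota> x * field_norm \<iota> y"
proof -
  interpret matrix_representation "ext_degree \<iota>" "mult_matrix \<iota>"
    by (rule matrix_representation_mult_matrix[OF assms])
  show ?thesis unfolding field_norm_def mult by (rule det_mult[OF carrier carrier])
qed

lemma field_norm_one:
  assumes "field_hom \<iota>" and "finite_extension \<iota>"
  shows "field_norm \<iota> 1 = 1"
proof -
  interpret matrix_representation "ext_degree \<iota>" "mult_matrix \<iota>"
    by (rule matrix_representation_mult_matrix[OF assms])
  show ?thesis by (simp add: field_norm_def one)
qed

lemma field_norm_eq_0_iff:
  assumes "field_hom \<iota>" and "finite_extension \<iota>"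
  shows "field_norm \<iota> x = 0 \<longleftrightarrow> x = 0"
proof
  interpret matrix_representation "ext_degree \<iota>" "mult_matrix \<iota>"
    by (rule matrix_representation_mult_matrix[OF assms])
  show "field_norm \<iota> x = 0" if "x = 0"
    using that dim_pos by (simp add: field_norm_def zero)
  show "x = 0" if "field_norm \<iota> x = 0"
  \<comment> \<open>A nonzero \<open>x\<close> is invertible, so its norm is a factor of the norm of
    1, which is 1.\<close>
  proof (rule ccontr)
    assume "x \<noteq> 0"
    then show False
      using that field_norm_mult[OF assms, of x "inverse x"] field_norm_one[OF assms] by simp
  qed
qed

section \<open>The scalar extension of the norm\<close>

text \<open>Serves to move evaluation over \<open>K\<close> inside the determinant that defines
  \<open>norm_poly\<close>.\<close>

lemma eval_map_mvpoly_hom: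
  assumes "field_hom \<kappa>"
  shows "comm_ring_hom (\<lambda>P. eval_mvpoly x (Poly_Mapping.map \<kappa> P))"
proof
  interpret \<kappa>: field_hom \<kappa> by fact
  let ?e = "\<lambda>P. eval_mvpoly x (Poly_Mapping.map \<kappa> P)"
  \<comment> \<open>\<open>Poly_Mapping.map\<close> keeps zero coefficients at zero, which agrees
    with \<open>\<kappa>\<close> because \<open>\<kappa> 0 = 0\<close>.\<close>
  have look: "Poly_Mapping.lookup (Poly_Mapping.map \<kappa> P) m = \<kappa> (Poly_Mapping.lookup P m)"
    for P :: "'a mvpoly" and m
    by (simp add: Poly_Mapping.map.rep_eq when_def)
  have "Poly_Mapping.map \<kappa> (0 :: 'a mvpoly) = 0"
    by (rule poly_mapping_eqI) (simp add: look)
  then show 0: "?e 0 = 0"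
    by (simp add: eval_mvpoly_def)
  show add: "?e (P + Q) = ?e P + ?e Q" for P Q
  proof -
    have "Poly_Mapping.map \<kappa> (P + Q) = Poly_Mapping.map \<kappa> P + Poly_Mapping.map \<kappa> Q"
      by (rule poly_mapping_eqI) (simp add: look lookup_add \<kappa>.hom_add)
    then show ?thesis by (simp add: eval_mvpoly_add)
  qed
  have single: "?e (Poly_Mapping.single m c) = \<kappa> c * eval_monom x m" for m c
    by (simp add: eval_mvpoly_single)
  show "?e 1 = 1"
    using single[of 0 1] by (simp add: eval_monom_def)
  have *: "?e (P * Poly_Mapping.single n d) = ?e P * ?e (Poly_Mapping.single n d)" for P n d
    by (induction P rule: mvpoly_induct)
       (simp_all add: 0 distrib_right add mult_single eval_mvpoly_single eval_monom_add \<kappa>.hom_mult)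
  show "?e (P * Q) = ?e P * ?e Q" for P Q
    by (induction Q rule: mvpoly_induct) (simp_all add: 0 distrib_left add *)
qed

text \<open>The matrix over \<open>K\<close>, in the basis of all \<open>b_i \<otimes> 1\<close>, of
  multiplication by the element of \<open>L \<otimes> K\<close> with coordinates
  \<open>w\<close>.\<close>

definition ext_mult_matrix ::
  "('f::field \<Rightarrow> 'l::field) \<Rightarrow> ('f \<Rightarrow> 'k::field) \<Rightarrow> 'k vec \<Rightarrow> 'k mat" where
  "ext_mult_matrix \<iota> \<kappa> w = mat (ext_degree \<iota>) (ext_degree \<iota>) (\<lambda>(i, j).
     \<Sum>k<ext_degree \<iota>. \<kappa> (mult_matrix \<iota> (ext_basis \<iota> ! k) $$ (i, j)) * w $ k)"

lemma norm_form_ext_eq_det: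
  assumes "field_hom \<kappa>"
  shows "norm_form_ext \<iota> \<kappa> w = det (ext_mult_matrix \<iota> \<kappa> w)"
proof -
  interpret \<kappa>: field_hom \<kappa> by fact
  let ?e = "\<lambda>P. eval_mvpoly (\<lambda>i. w $ i) (Poly_Mapping.map \<kappa> P)"
  interpret e: comm_ring_hom ?e by (rule eval_map_mvpoly_hom) fact
  show ?thesis
    unfolding norm_form_ext_def norm_poly_def ext_mult_matrix_def e.hom_det[symmetric]
    by (intro arg_cong[where f = det] eq_matI)
       (auto simp: e.hom_sum eval_mvpoly_single eval_monom_def simp del: One_nat_def)
qed

text \<open>The vector is \<open>x \<otimes> 1\<close> in coordinates. By linearity of
  \<open>mult_matrix\<close>, multiplication by it has the matrix of \<open>x\<close> with its
  entries mapped to \<open>K\<close>.\<close>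

lemma norm_form_ext_coord:
  assumes "field_hom \<iota>" and "finite_extension \<iota>" and "field_hom \<kappa>"
  shows "norm_form_ext \<iota> \<kappa> (vec (ext_degree \<iota>) (\<lambda>i. \<kappa> (ext_coord \<iota> x i))) =
    \<kappa> (field_norm \<iota> x)"
proof -
  interpret \<kappa>: field_hom \<kappa> by fact
  interpret matrix_representation "ext_degree \<iota>" "mult_matrix \<iota>"
    by (rule matrix_representation_mult_matrix[OF assms(1,2)])
  let ?n = "ext_degree \<iota>" and ?b = "\<lambda>k. ext_basis \<iota> ! k"
  have "mult_matrix \<iota> x $$ (i, j) =
      (\<Sum>k<?n. ext_coord \<iota> x k * mult_matrix \<iota> (?b k) $$ (i, j))" if "i < ?n" "j < ?n" for i j
    by (subst sum_ext_coord[OF assms(1,2), of x, symmetric])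
       (simp add: sum_entry that mult_matrix_scale_entry[OF assms(1,2)])
  then have "ext_mult_matrix \<iota> \<kappa> (vec ?n (\<lambda>i. \<kappa> (ext_coord \<iota> x i))) =
      map_mat \<kappa> (mult_matrix \<iota> x)"
    by (intro eq_matI) (auto simp: ext_mult_matrix_def \<kappa>.hom_sum \<kappa>.hom_mult mult.commute)
  then show ?thesis
    by (simp add: norm_form_ext_eq_det[OF assms(3)] field_norm_def \<kappa>.hom_det)
qed

text \<open>The witness \<open>y\<close> is the norm of \<open>w \<in> L \<otimes>\<^sub>F K\<close> down to \<open>L\<close>.\<close>

lemma field_norm_norm_form_ext:
  assumes "field_hom \<iota>" and "finite_extension \<iota>" and "field_hom \<kappa>" and "finite_extension \<kappa>"
  shows "\<exists>y. field_norm \<kappa> (norm_form_ext \<iota> \<kappa> w) = field_norm \<iota> y"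
proof
  interpret L: matrix_representation "ext_degree \<iota>" "mult_matrix \<iota>"
    by (rule matrix_representation_mult_matrix[OF assms(1,2)])
  interpret K: matrix_representation "ext_degree \<kappa>" "mult_matrix \<kappa>"
    by (rule matrix_representation_mult_matrix[OF assms(3,4)])
  let ?n = "ext_degree \<iota>" and ?m = "ext_degree \<kappa>" and ?b = "\<lambda>k. ext_basis \<iota> ! k"
  \<comment> \<open>The entries over \<open>F\<close> of multiplication by the sum of all
    \<open>b_k \<otimes> w_k\<close>: the indices \<open>a\<close>, \<open>b\<close> refer to the
    basis of \<open>L\<close>, and \<open>c\<close>, \<open>d\<close> to that of
    \<open>K\<close>.\<close>
  define g where "g a b c d =
    (\<Sum>k<?n. mult_matrix \<iota> (?b k) $$ (a, b) * mult_matrix \<kappa> (w $ k) $$ (c, d))" for a b c d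
  \<comment> \<open>The same multiplication as a matrix over \<open>L\<close>, in the basis of
    \<open>L \<otimes> K\<close> that comes from the basis of \<open>K\<close>. Its determinant is
    the witness.\<close>
  define N where "N = mat ?m ?m (\<lambda>(c, d). \<Sum>k<?n. \<iota> (mult_matrix \<kappa> (w $ k) $$ (c, d)) * ?b k)"
  have "K.block ?n (ext_mult_matrix \<iota> \<kappa> w) = mat (?n * ?m) (?n * ?m)
      (\<lambda>(i, j). g (i div ?m) (j div ?m) (i mod ?m) (j mod ?m))"
    by (rule eq_matI) (auto simp: K.block_def ext_mult_matrix_def g_def K.sum_entry K.div_less
        K.mod_less mult_matrix_scale_entry[OF assms(3,4)])
  moreover have "L.block ?m N = mat (?m * ?n) (?m * ?n)
      (\<lambda>(i, j). g (i mod ?n) (j mod ?n) (i div ?n) (j div ?n))"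
    by (rule eq_matI) (auto simp: L.block_def N_def g_def L.sum_entry L.div_less
        L.mod_less mult_matrix_scale_entry[OF assms(1,2)]
        mult.commute[of "mult_matrix \<kappa> _ $$ _"])
  ultimately have "det (K.block ?n (ext_mult_matrix \<iota> \<kappa> w)) = det (L.block ?m N)"
    by (simp only: det_block_interchange)
  then show "field_norm \<kappa> (norm_form_ext \<iota> \<kappa> w) = field_norm \<iota> (det N)"
    by (simp add: field_norm_def norm_form_ext_eq_det[OF assms(3)] K.det_block L.det_block
        ext_mult_matrix_def N_def)
qed

section \<open>Scaling by norms and the norm principle\<close>

lemma forms_isomorphic_field_norm_scale:
  assumes "field_hom \<iota>" and "finite_extension \<iota>" and "y \<noteq> 0"
  shows "forms_isomorphic (ext_scale \<iota>) UNIV (\<lambda>x. field_norm \<iota> y * field_norm \<iota> x)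
    (ext_scale \<iota>) UNIV (field_norm \<iota>)"
  unfolding forms_isomorphic_def
proof (intro exI[of _ "\<lambda>x. y * x"] conjI)
  show "bij_betw (\<lambda>x. y * x) UNIV UNIV"
    by (rule bij_betw_byWitness[where f' = "\<lambda>x. x / y"]) (use assms(3) in auto)
qed (simp_all add: distrib_left ext_scale_def mult.left_commute field_norm_mult[OF assms(1,2)])

theorem theorem4:
  fixes \<iota> :: "'f::field \<Rightarrow> 'l::field"
    and \<kappa> :: "'f \<Rightarrow> 'k::field"
    and \<alpha> :: 'l and a :: 'k and p :: nat
  assumes "prime p"
    and "CHAR('f) = 0 \<or> CHAR('f) > p"
    and "field_hom \<iota>"
    and "ext_degree \<iota> = p"
    and "adjoin \<iota> \<alpha> = UNIV"
    and "field_hom \<kappa>"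
    and "finite_galois_extension \<kappa>"
    and "a \<noteq> 0"
    and "forms_isomorphic
           (\<cdot>\<^sub>v) (norm_space_ext \<iota> \<kappa>) (\<lambda>v. a * norm_form_ext \<iota> \<kappa> v)
           (\<cdot>\<^sub>v) (norm_space_ext \<iota> \<kappa>) (norm_form_ext \<iota> \<kappa>)"
  shows "forms_isomorphic
           (ext_scale \<iota>) UNIV (\<lambda>x. field_norm \<kappa> a * field_norm \<iota> x)
           (ext_scale \<iota>) UNIV (field_norm \<iota>)"
proof -
  interpret \<kappa>: field_hom \<kappa> by fact
  \<comment> \<open>Infinite extensions have degree 0 by convention, so a prime degree forces
    finiteness.\<close>
  have \<iota>: "field_hom \<iota>" "finite_extension \<iota>"
    using assms(1,3,4) by (auto intro!: finite_extensionI_degree simp: prime_gt_0_nat)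
  have \<kappa>: "field_hom \<kappa>" "finite_extension \<kappa>"
    using assms(6,7) by (auto simp: finite_galois_extension_def)
  \<comment> \<open>\<open>e\<close> is \<open>1 \<otimes> 1\<close> in coordinates, where the
    extended form takes the value 1.\<close>
  define e where "e = vec (ext_degree \<iota>) (\<lambda>i. \<kappa> (ext_coord \<iota> 1 i))"
  have "e \<in> norm_space_ext \<iota> \<kappa>" by (simp add: e_def norm_space_ext_def)
  \<comment> \<open>\<open>w\<close> is the image of \<open>e\<close> under the given
    isomorphism.\<close>
  then obtain w where "norm_form_ext \<iota> \<kappa> w = a * norm_form_ext \<iota> \<kappa> e"
    using assms(9) unfolding forms_isomorphic_def by blast
  also have "norm_form_ext \<iota> \<kappa> e = 1"
    unfolding e_def norm_form_ext_coord[OF \<iota> \<kappa>(1)] by (simp add: field_norm_one[OF \<iota>])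
  finally have "norm_form_ext \<iota> \<kappa> w = a" by simp
  then obtain y where y: "field_norm \<kappa> a = field_norm \<iota> y"
    using field_norm_norm_form_ext[OF \<iota> \<kappa>] by metis
  \<comment> \<open>Both norms vanish exactly at 0, so \<open>a \<noteq> 0\<close> carries over to
    \<open>y\<close>.\<close>
  have "y \<noteq> 0"
    using y assms(8) field_norm_eq_0_iff[OF \<iota>] field_norm_eq_0_iff[OF \<kappa>] by metis
  then show ?thesis
    unfolding y by (rule forms_isomorphic_field_norm_scale[OF \<iota>])
qed

end
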